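(* Let $x$ and $y$ be indeterminates and let $F_n(x,y)$, $n\ge0$, be the Savage-Viswanathan polynomials. Then for all $n\ge 0$ $$F_n(x,y)=\sum_{k=0}^n\sum_{j=0}^n S_{n,j}\,(x-1)^{n-j}\,|s_{j,k}|\,y^k,$$ where $S_{n,j}$ are the Stirling numbers of the second kind and $|s_{j,k}|$ are the unsigned Stirling numbers of the first kind.
   Context: The Savage-Viswanathan polynomials $F_n(x,y)$ are defined by the exponential generating function $\sum_{n\ge 0}F_n(x,y)\frac{z^n}{n!}=\left(\frac{1-x}{e^{z(x-1)}-x}\right)^y$ (a formal power series in $z$; the base has constant term $1$, and $u^y=\exp(y\ln u)$). They are polynomials in $x,y$. Conventions: $S_{0,0}=|s_{0,0}|=1$, and $|s_{j,k}|=0$ for $k>j$. *)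

theory Defs
  imports
    "HOL-Computational_Algebra.Computational_Algebra"
    "HOL-Combinatorics.Stirling"
begin

text \<open>
  The indeterminates live in \<open>\<rat>[x][y]\<close>: \<open>y\<close> is the outer polynomial variable, \<open>x\<close> the inner one.
\<close>

definition indet_x :: "rat poly poly" where
  "indet_x = [:[:0, 1:]:]"

definition indet_y :: "rat poly poly" where
  "indet_y = [:0, 1:]"

text \<open>
  \<open>fps_ln 1\<close> is the series \<open>ln (1 + z)\<close>. Composition of formal power series is meaningful only when
  the inner series has constant term 0, so this is \<open>u\<^sup>a = exp (a ln u)\<close> for \<open>u\<close> with constant term 1.
\<close>

definition fps_power :: "'a :: field_char_0 fps \<Rightarrow> 'a \<Rightarrow> 'a fps" where
  "fps_power u a = fps_exp 1 oo (fps_const a * (fps_ln 1 oo (u - 1)))"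

text \<open>
  The division by \<open>e\<^bsup>z(x-1)\<^esup> - x\<close>, whose constant term \<open>1 - x\<close> is not a unit of \<open>\<rat>[x,y]\<close>, takes
  place over the field \<open>\<rat>(x,y)\<close>.
\<close>

definition SV_gf :: "rat poly poly fract fps" where
  "SV_gf = (let x = to_fract indet_x; y = to_fract indet_y
            in fps_power (fps_const (1 - x) / (fps_exp (x - 1) - fps_const x)) y)"

text \<open>
  The coefficients of \<open>SV_gf\<close> lie in \<open>\<rat>[x,y]\<close>, and \<open>to_fract\<close> is injective, so that the description
  determines a unique sequence of polynomials.
\<close>

definition SV_poly :: "nat \<Rightarrow> rat poly poly" where
  "SV_poly = (THE F. Abs_fps (\<lambda>n. to_fract (F n) / fact n) = SV_gf)"

end

theory Submission
  imports Defs
begin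

text \<open>
  With \<open>w = (e\<^bsup>z(x-1)\<^esup> - 1) / (x - 1)\<close> the base of the generating function is \<open>1 / (1 - w)\<close>. By the
  binomial series its \<open>y\<close>-th power is the sum of \<open>y (y + 1) \<cdots> (y + j - 1) w\<^sup>j / j!\<close>. Expanding the
  rising factorials in powers of \<open>y\<close> gives the numbers of the first kind, and expanding \<open>w\<^sup>j / j!\<close> in
  powers of \<open>z\<close> gives those of the second kind.
\<close>

text \<open>The coefficient of \<open>z^m\<close> in the equation determines
  \<open>(m + 1) * f $ (m + 1)\<close> from \<open>f $ 0\<close>, ..., \<open>f $ m\<close>, and
  \<open>m + 1\<close> is nonzero in characteristic 0.\<close>

lemma fps_linear_ODE_unique:
  fixes f g h :: "'a :: field_char_0 fps"
  assumes f: "fps_deriv f = h * f" and g: "fps_deriv g = h * g" and "f $ 0 = g $ 0"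
  shows "f = g"
proof (rule fps_ext)
  fix n
  show "f $ n = g $ n"
  proof (induction n rule: less_induct)
    case (less n)
    show ?case
    proof (cases n)
      case 0
      then show ?thesis using assms(3) by simp
    next
      case (Suc m)
      have "of_nat (Suc m) * f $ Suc m = (\<Sum>i=0..m. h $ i * f $ (m - i))"
        using arg_cong[OF f, of "\<lambda>F. F $ m"] by (simp add: fps_mult_nth)
      also have "\<dots> = (\<Sum>i=0..m. h $ i * g $ (m - i))"
        using less Suc by (intro sum.cong) auto
      also have "\<dots> = of_nat (Suc m) * g $ Suc m"
        using arg_cong[OF g, of "\<lambda>F. F $ m"] by (simp add: fps_mult_nth)
      finally show ?thesis
        unfolding Suc using of_nat_neq_0[of m, where 'a = 'a] mult_left_cancel by blast
    qed
  qed
qed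

lemma fps_power_nth_0 [simp]: "fps_power u a $ 0 = 1"
  by (simp add: fps_power_def)

text \<open>By the chain rule, since \<open>ln u\<close> has derivative \<open>u' / u\<close>.
  Keeping the power itself on the right instead of lowering the exponent gives the shape
  \<open>h * f\<close> of \<open>fps_linear_ODE_unique\<close>.\<close>

lemma fps_deriv_fps_power:
  assumes "u $ 0 = 1"
  shows "fps_deriv (fps_power u a) = fps_const a * inverse u * fps_deriv u * fps_power u a"
proof -
  have "inverse (1 + fps_X) oo (u - 1) = inverse u"
    using assms by (subst fps_inverse_compose) (simp_all add: fps_compose_add_distrib)
  then show ?thesis
    using assms by (simp add: fps_power_def fps_compose_deriv fps_ln_deriv mult_ac)
qed

text \<open>The equation satisfied by \<open>(1 - X)^(-a)\<close>. On coefficients it is the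
  recurrence \<open>(k + 1) P_(k+1) = (a + k) P_k\<close>.\<close>

lemma fps_deriv_pochhammer_series:
  fixes a :: "'a :: field_char_0"
  defines "P \<equiv> Abs_fps (\<lambda>j. pochhammer a j / fact j)"
  shows "(1 - fps_X) * fps_deriv P = fps_const a * P"
proof (rule fps_ext)
  fix n
  have *: "of_nat (Suc k) * P $ Suc k = (a + of_nat k) * P $ k" for k
    by (simp add: P_def pochhammer_Suc divide_simps del: of_nat_Suc)
  show "((1 - fps_X) * fps_deriv P) $ n = (fps_const a * P) $ n"
    using *[of n] by (cases n) (simp_all add: algebra_simps)
qed

text \<open>Both sides have constant term 1 and solve
  \<open>f' = a w' / (1 - w) * f\<close>.\<close>

lemma fps_power_inverse_one_minus:
  fixes a :: "'a :: field_char_0"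
  assumes w: "w $ 0 = 0"
  shows "fps_power (inverse (1 - w)) a = Abs_fps (\<lambda>j. pochhammer a j / fact j) oo w"
proof -
  define P where "P = Abs_fps (\<lambda>j. pochhammer a j / fact j)"
  let ?u = "inverse (1 - w)"
  have unit: "?u * (1 - w) = 1"
    using w by (intro inverse_mult_eq_1) simp
  have "(1 - w) * (fps_deriv P oo w) = ((1 - fps_X) * fps_deriv P) oo w"
    using w by (simp add: fps_compose_mult_distrib fps_compose_sub_distrib)
  also have "\<dots> = fps_const a * (P oo w)"
    using w by (simp add: P_def fps_deriv_pochhammer_series fps_compose_mult_distrib)
  finally have "?u * (1 - w) * (fps_deriv P oo w) = ?u * (fps_const a * (P oo w))"
    by (simp only: mult.assoc)
  then have "fps_deriv P oo w = ?u * (fps_const a * (P oo w))"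
    by (simp only: unit mult_1)
  then have dP: "fps_deriv (P oo w) = fps_const a * ?u * fps_deriv w * (P oo w)"
    using w by (simp add: fps_compose_deriv mult_ac)
  \<comment> \<open>The logarithmic derivative of \<open>1 / (1 - w)\<close> is
    \<open>w' / (1 - w)\<close>, which matches the factor in \<open>dP\<close>.\<close>
  have "inverse ?u * fps_deriv ?u = (1 - w) * (fps_deriv w * ?u\<^sup>2)"
    using w by (simp add: fps_inverse_deriv fps_inverse_idempotent)
  also have "\<dots> = ?u * (1 - w) * (?u * fps_deriv w)"
    by (simp add: power2_eq_square mult_ac)
  finally have "inverse ?u * fps_deriv ?u = ?u * fps_deriv w"
    using unit by simp
  then have "fps_deriv (fps_power ?u a) = fps_const a * ?u * fps_deriv w * fps_power ?u a"
    using w by (simp add: fps_deriv_fps_power mult.assoc)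
  from this dP have "fps_power ?u a = P oo w"
    by (rule fps_linear_ODE_unique) (simp add: P_def)
  then show ?thesis by (simp add: P_def)
qed

text \<open>With \<open>E = exp (c z) - 1\<close>, the identity \<open>E' = c (E + 1)\<close> turns
  differentiation of \<open>E^j\<close> into the recurrence
  \<open>S(n+1,j) = j S(n,j) + S(n,j-1)\<close>.\<close>

lemma fps_exp_minus_one_power_nth:
  fixes c :: "'a :: field_char_0"
  shows "((fps_exp c - 1) ^ j) $ n = fact j * of_nat (Stirling n j) * c ^ n / fact n"
proof (induction n arbitrary: j)
  case 0
  then show ?case by (cases j) (simp_all add: fps_nth_power_0)
next
  case (Suc n)
  show ?case
  proof (cases j)
    case 0
    then show ?thesis by simp
  next
    case (Suc i)
    let ?E = "fps_exp c - 1 :: 'a fps"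
    have "fps_deriv (?E ^ j) = of_nat j * fps_const c * (?E + 1) * ?E ^ i"
      unfolding Suc fps_deriv_power' by simp
    also have "\<dots> = fps_const (of_nat j * c) * (?E ^ j + ?E ^ i)"
      using Suc by (simp add: algebra_simps flip: fps_of_nat)
    finally have "of_nat (Suc n) * (?E ^ j) $ Suc n = of_nat j * c * ((?E ^ j) $ n + (?E ^ i) $ n)"
      by (metis fps_add_nth fps_deriv_nth fps_mult_left_const_nth Suc_eq_plus1)
    also have "\<dots> = of_nat (Suc n) * (fact j * of_nat (Stirling (Suc n) j) * c ^ Suc n / fact (Suc n))"
      unfolding Suc.IH unfolding Suc
      by (simp add: divide_simps del: of_nat_Suc) (simp add: algebra_simps)
    finally show ?thesis
      using of_nat_neq_0[of n, where 'a = 'a] mult_left_cancel by blast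
  qed
qed

text \<open>The denominator factors as \<open>(1 - x) (1 - w)\<close>, and the unit
  \<open>1 - x\<close> cancels.\<close>

lemma SV_base_eq:
  fixes x :: "'a :: field_char_0"
  assumes "x \<noteq> 1"
  shows "fps_const (1 - x) / (fps_exp (x - 1) - fps_const x) =
    inverse (1 - fps_const (inverse (x - 1)) * (fps_exp (x - 1) - 1))"
proof -
  let ?w = "fps_const (inverse (x - 1)) * (fps_exp (x - 1) - 1)"
  have "fps_const (1 - x) * ?w = fps_const ((1 - x) * inverse (x - 1)) * (fps_exp (x - 1) - 1)"
    by (simp only: fps_const_mult[symmetric] mult.assoc)
  also have "(1 - x) * inverse (x - 1) = - 1"
    using assms by (simp add: field_simps)
  finally have "fps_const (1 - x) * (1 - ?w) =
      fps_const (1 - x) - fps_const (- 1) * (fps_exp (x - 1) - 1)"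
    by (simp only: right_diff_distrib mult_1_right)
  then have "fps_exp (x - 1) - fps_const x = fps_const (1 - x) * (1 - ?w)"
    by (simp flip: fps_const_sub fps_const_neg)
  then show ?thesis
    using assms by (simp add: fps_divide_unit fps_inverse_mult fps_const_inverse mult.assoc[symmetric])
qed

lemma SV_gf_nth:
  fixes x y :: "'a :: field_char_0"
  assumes "x \<noteq> 1"
  shows "fps_power (fps_const (1 - x) / (fps_exp (x - 1) - fps_const x)) y $ n =
    (\<Sum>k=0..n. \<Sum>j=0..n.
      of_nat (Stirling n j) * (x - 1) ^ (n - j) * of_nat (stirling j k) * y ^ k) / fact n"
proof -
  let ?w = "fps_const (inverse (x - 1)) * (fps_exp (x - 1) - 1)"
  \<comment> \<open>The factor \<open>(x - 1)^(-j)\<close> from \<open>w^j\<close> combines with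
    \<open>(x - 1)^n\<close> from the exponential; \<open>j \<le> n\<close> makes the exponent
    \<open>n - j\<close> a genuine difference.\<close>
  have w: "(?w ^ j) $ n = fact j * of_nat (Stirling n j) * (x - 1) ^ (n - j) / fact n"
    if "j \<le> n" for j
  proof -
    have "(?w ^ j) $ n = inverse (x - 1) ^ j * ((fps_exp (x - 1) - 1) ^ j) $ n"
      by (simp only: power_mult_distrib fps_const_power fps_mult_left_const_nth)
    then show ?thesis
      using assms that by (simp add: fps_exp_minus_one_power_nth power_diff field_simps)
  qed
  \<comment> \<open>The added terms vanish because \<open>stirling j k = 0\<close> for
    \<open>k > j\<close>; a range independent of \<open>j\<close> lets the two sums be
    swapped.\<close>
  have p: "pochhammer y j = (\<Sum>k=0..n. of_nat (stirling j k) * y ^ k)" if "j \<le> n" for j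
    unfolding stirling_pochhammer[symmetric] using that
    by (intro sum.mono_neutral_left) auto
  have "fps_power (fps_const (1 - x) / (fps_exp (x - 1) - fps_const x)) y $ n =
      (\<Sum>j=0..n. pochhammer y j / fact j * (?w ^ j) $ n)"
    using assms by (simp add: SV_base_eq fps_power_inverse_one_minus fps_compose_nth)
  also have "\<dots> = (\<Sum>j=0..n. of_nat (Stirling n j) * (x - 1) ^ (n - j) * pochhammer y j) / fact n"
    unfolding sum_divide_distrib by (intro sum.cong) (simp_all add: w)
  also have "(\<Sum>j=0..n. of_nat (Stirling n j) * (x - 1) ^ (n - j) * pochhammer y j) =
      (\<Sum>j=0..n. \<Sum>k=0..n. of_nat (Stirling n j) * (x - 1) ^ (n - j) * of_nat (stirling j k) * y ^ k)"
    by (intro sum.cong) (simp_all add: p sum_distrib_left mult.assoc)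
  also have "\<dots> = (\<Sum>k=0..n. \<Sum>j=0..n.
      of_nat (Stirling n j) * (x - 1) ^ (n - j) * of_nat (stirling j k) * y ^ k)"
    by (rule sum.swap)
  finally show ?thesis .
qed

lemma to_fract_of_nat: "to_fract (of_nat n) = of_nat n"
  by (induction n) simp_all

lemma to_fract_power: "to_fract (a ^ n) = to_fract a ^ n"
  by (induction n) simp_all

theorem mainTheorem11:
  fixes n :: nat
  shows "SV_poly n =
    (\<Sum>k=0..n. \<Sum>j=0..n.
      of_nat (Stirling n j) * (indet_x - 1) ^ (n - j) * of_nat (stirling j k) * indet_y ^ k)"
proof -
  define F where "F = (\<lambda>n. \<Sum>k=0..n. \<Sum>j=0..n.
    of_nat (Stirling n j) * (indet_x - 1) ^ (n - j) * of_nat (stirling j k) * indet_y ^ k)"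
  have "indet_x \<noteq> 1"
    by (simp add: indet_x_def one_pCons)
  \<comment> \<open>Injectivity of \<open>to_fract\<close> carries the hypothesis of
    \<open>SV_gf_nth\<close> over to the fraction field.\<close>
  then have "to_fract indet_x \<noteq> 1"
    by (metis to_fract_1 to_fract_eq_iff)
  then have F: "Abs_fps (\<lambda>n. to_fract (F n) / fact n) = SV_gf"
    by (intro fps_ext)
      (simp add: SV_gf_def Let_def SV_gf_nth F_def to_fract_of_nat to_fract_power)
  have "SV_poly = F"
    unfolding SV_poly_def
  proof (rule the_equality)
    \<comment> \<open>Uniqueness for \<open>THE\<close>: the factorials cancel coefficientwise and
      \<open>to_fract\<close> is injective.\<close>
    fix G assume "Abs_fps (\<lambda>n. to_fract (G n) / fact n) = SV_gf"
    with F have "to_fract (G n) / fact n = to_fract (F n) / fact n" for n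
      by (metis fps_nth_Abs_fps)
    then show "G = F" by (intro ext) simp
  qed (fact F)
  from fun_cong[OF this, of n] show ?thesis by (simp only: F_def)
qed

end
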